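(* Let $f:\mathbb{R}^n\to\mathbb{R}$ and $c:\mathbb{R}^n\to\mathbb{R}^m$ be twice continuously differentiable, and consider the problem (NLP) $\min_x f(x)$ s.t. $c(x)\ge0$ and its squared-slack reformulation (SSV) $\min_{x,v} f(x)$ s.t. $c(x)-v\odot v=0$. Suppose that $(x,v,s)\in\mathbb{R}^n\times\mathbb{R}^m\times\mathbb{R}^m$ is an $(\epsilon_1,\epsilon_2,\epsilon_3)$-approximate 2N point for (SSV) with $\epsilon_i\in(0,1]$, $i=1,2,3$. Choose $\zeta\ge2\epsilon_2$ to define the approximately active set $\mathcal{A}_\zeta=\{i\mid c_i(x)\le\zeta\}$, and suppose that the active constraint Jacobian $J_{\mathcal{A}_\zeta}(x):=[\nabla c_i(x)^T]_{i\in\mathcal{A}_\zeta}$ (the matrix with rows $\nabla c_i(x)^T$, $i\in\mathcal{A}_\zeta$) has full row rank. Then there are positive quantities $\epsilon_{\rm foc},\epsilon_{\rm pf},\epsilon_{\rm cs},\epsilon_{\rm pd},\epsilon_{\rm soc}$ satisfying $$\epsilon_{\rm foc}=\epsilon_1,\quad \epsilon_{\rm pf}=\epsilon_2,\quad \epsilon_{\rm cs}=O(\epsilon_1+\epsilon_2),$$ $$\epsilon_{\rm pd}=O\Big(\frac{\epsilon_1}{\zeta^{1/2}}+\epsilon_2+\epsilon_3\Big),\quad \epsilon_{\rm soc}=O\Big(\epsilon_3+\frac{\epsilon_3}{\zeta}+\frac{\epsilon_1}{\zeta^{3/2}}\Big),$$ such that $(x,s)$ is an $(\epsilon_{\rm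 foc},\epsilon_{\rm pf},\epsilon_{\rm cs},\epsilon_{\rm pd},\epsilon_{\rm soc},\zeta)$-approximate 2N point for (NLP). Here the constants hidden in $O(\cdot)$ depend only on the constraint values $c(x)$, the Jacobian matrix of the constraints at $x$, the Lagrange multiplier vector $s$, and the Hessian matrix $\nabla^2_{xx}\mathcal{L}_o(x,s)$.
   Context: $\odot$ is the componentwise product. $\mathcal{L}_o(x,s)=f(x)-\sum_{i=1}^m s_ic_i(x)$ is the Lagrangian of (NLP). Approximate 2N point for (SSV): $(x,v,s)$ is an $(\epsilon_1,\epsilon_2,\epsilon_3)$-approximate 2N point if (i) the stacked vector $\big(\nabla f(x)-\sum_{i=1}^m s_i\nabla c_i(x),\ 2s\odot v\big)\in\mathbb{R}^{n+m}$ has Euclidean norm at most $\epsilon_1$; (ii) $\|c(x)-v\odot v\|_2\le\epsilon_2$; (iii) for all $(w,z)\in\mathbb{R}^n\times\mathbb{R}^m$ with $\nabla c_i(x)^Tw=2v_iz_i$, $i=1,\dots,m$, we have $w^T\nabla^2_{xx}\mathcal{L}_o(x,s)w+2\sum_{i=1}^m s_iz_i^2\ge-\epsilon_3\|(w,z)\|_2^2$. Approximate 2N point for (NLP): $(x,s)\in\mathbb{R}^n\times\mathbb{R}^m$ is an $(\epsilon_{\rm foc},\epsilon_{\rm pf},\epsilon_{\rm cs},\epsilon_{\rm pd},\epsilon_{\rm soc},\zeta)$-approximate 2N point if (a) $\|\nabla_x\mathcal{L}_o(x,s)\|_2\le\epsilon_{\rm foc}$; (b) $c_i(x)\ge-\epsilon_{\rm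 pf}$ for all $i$; (c) $\|s\odot c(x)\|_2\le\epsilon_{\rm cs}$; (d) $s_i+a_ic_i(x)\ge-\epsilon_{\rm pd}$ for all $i=1,\dots,m$, for some $a_i\ge0$ independent of $(\epsilon_{\rm foc},\epsilon_{\rm pf},\epsilon_{\rm cs},\epsilon_{\rm pd},\epsilon_{\rm soc})$ (but possibly depending on $x$ and $s$); (e) for all $w\in\mathbb{R}^n$ with $\nabla c_i(x)^Tw=0$ for all $i\in\mathcal{A}_\zeta=\{i\mid c_i(x)\le\zeta\}$, we have $w^T\nabla^2_{xx}\mathcal{L}_o(x,s)w\ge-\epsilon_{\rm soc}\|w\|_2^2$. *)

theory Defs
  imports "HOL-Analysis.Analysis"
begin

section \<open>First and second derivatives on \<open>\<real>\<^sup>n\<close>\<close>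

definition grad :: "(real^'n \<Rightarrow> real) \<Rightarrow> real^'n \<Rightarrow> real^'n" where
  "grad f x = (\<chi> j. frechet_derivative f (at x) (axis j 1))"

definition hessian :: "(real^'n \<Rightarrow> real) \<Rightarrow> real^'n \<Rightarrow> real^'n^'n" where
  "hessian f x = jacobian (grad f) (at x)"

definition twice_continuously_differentiable :: "(real^'n \<Rightarrow> real) \<Rightarrow> bool" where
  "twice_continuously_differentiable f \<longleftrightarrow>
     (\<forall>x. f differentiable (at x)) \<and>
     (\<forall>x. grad f differentiable (at x)) \<and>
     continuous_on UNIV (hessian f)"

lemma GDERIV_grad:
  fixes f :: "real^'n \<Rightarrow> real"
  assumes "f differentiable (at x)"
  shows "GDERIV f x :> grad f x"
proof -
  let ?F = "frechet_derivative f (at x)"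
  have d: "(f has_derivative ?F) (at x)"
    using assms frechet_derivative_works by blast
  then have l: "linear ?F"
    by (rule has_derivative_linear)
  have "?F h = h \<bullet> grad f x" for h
  proof -
    have "?F h = ?F (\<Sum>i\<in>UNIV. h $ i *s axis i 1)"
      by (simp add: basis_expansion)
    also have "\<dots> = (\<Sum>i\<in>UNIV. h $ i * ?F (axis i 1))"
      by (simp add: linear_sum[OF l] linear_scale[OF l] scalar_mult_eq_scaleR)
    finally show ?thesis
      by (simp add: grad_def inner_vec_def)
  qed
  then have "?F = (\<lambda>h. h \<bullet> grad f x)" by auto
  with d show ?thesis
    by (simp add: gderiv_def)
qed

lemma row_jacobian:
  fixes c :: "real^'n \<Rightarrow> real^'m"
  assumes "c differentiable (at x)"
  shows "row i (jacobian c (at x)) = grad (\<lambda>y. c y $ i) x"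
proof -
  have "(c has_derivative frechet_derivative c (at x)) (at x)"
    using assms frechet_derivative_works by blast
  then have "((\<lambda>y. c y $ i) has_derivative (\<lambda>h. frechet_derivative c (at x) h $ i)) (at x)"
    by (rule bounded_linear.has_derivative[OF bounded_linear_vec_nth])
  then have "frechet_derivative (\<lambda>y. c y $ i) (at x) = (\<lambda>h. frechet_derivative c (at x) h $ i)"
    by (rule frechet_derivative_at[symmetric])
  then show ?thesis
    by (simp add: grad_def row_def jacobian_def matrix_def)
qed

section \<open>Nonlinear programs and approximate second-order points\<close>

text \<open>
  (NLP) minimises \<open>f x\<close> subject to \<open>c x \<ge> 0\<close>, and (SSV) minimises \<open>f x\<close> over \<open>(x, v)\<close> subject to
  \<open>c x - v * v = 0\<close>. Multiplication of vectors of type \<^typ>\<open>real^'m\<close> is componentwise, and the norm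
  of a pair is the Euclidean norm of the stacked vector.
\<close>

definition lagrangian ::
  "(real^'n \<Rightarrow> real) \<Rightarrow> (real^'n \<Rightarrow> real^'m) \<Rightarrow> real^'m \<Rightarrow> real^'n \<Rightarrow> real" where
  "lagrangian f c s x = f x - (\<Sum>i\<in>UNIV. s $ i * c x $ i)"

definition approx_active_set :: "(real^'n \<Rightarrow> real^'m) \<Rightarrow> real^'n \<Rightarrow> real \<Rightarrow> 'm set" where
  "approx_active_set c x \<zeta> = {i. c x $ i \<le> \<zeta>}"

text \<open>
  Full row rank of the submatrix of \<open>J\<close> formed by the rows in \<open>A\<close>: its rank, i.e. the dimension of
  its row space (see \<open>row_rank_def\<close>), equals its number of rows.
\<close>

definition full_row_rank_on :: "'m set \<Rightarrow> real^'n^'m \<Rightarrow> bool" where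
  "full_row_rank_on A J \<longleftrightarrow> dim ((\<lambda>i. row i J) ` A) = card A"

definition SSV_approx_2N_point ::
  "(real^'n \<Rightarrow> real) \<Rightarrow> (real^'n \<Rightarrow> real^'m) \<Rightarrow> real^'n \<Rightarrow> real^'m \<Rightarrow> real^'m \<Rightarrow>
    real \<Rightarrow> real \<Rightarrow> real \<Rightarrow> bool" where
  "SSV_approx_2N_point f c x v s \<epsilon>1 \<epsilon>2 \<epsilon>3 \<longleftrightarrow>
     norm (grad f x - (\<Sum>i\<in>UNIV. s $ i *\<^sub>R grad (\<lambda>y. c y $ i) x), 2 *\<^sub>R (s * v)) \<le> \<epsilon>1 \<and>
     norm (c x - v * v) \<le> \<epsilon>2 \<and>
     (\<forall>(w :: real^'n) (z :: real^'m).
        (\<forall>i. grad (\<lambda>y. c y $ i) x \<bullet> w = 2 * v $ i * z $ i) \<longrightarrow>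
        w \<bullet> (hessian (lagrangian f c s) x *v w) + 2 * (\<Sum>i\<in>UNIV. s $ i * (z $ i)\<^sup>2)
          \<ge> - \<epsilon>3 * (norm (w, z))\<^sup>2)"

text \<open>
  The coefficients \<open>a\<close> of condition (d) are a parameter rather than bound inside the definition:
  they must not depend on the tolerances, which can only be expressed where the tolerances are
  quantified.
\<close>

definition NLP_approx_2N_point ::
  "(real^'n \<Rightarrow> real) \<Rightarrow> (real^'n \<Rightarrow> real^'m) \<Rightarrow> real^'m \<Rightarrow> real^'n \<Rightarrow> real^'m \<Rightarrow>
    real \<Rightarrow> real \<Rightarrow> real \<Rightarrow> real \<Rightarrow> real \<Rightarrow> real \<Rightarrow> bool" where
  "NLP_approx_2N_point f c a x s \<epsilon>foc \<epsilon>pf \<epsilon>cs \<epsilon>pd \<epsilon>soc \<zeta> \<longleftrightarrow>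
     norm (grad (lagrangian f c s) x) \<le> \<epsilon>foc \<and>
     (\<forall>i. c x $ i \<ge> - \<epsilon>pf) \<and>
     norm (s * c x) \<le> \<epsilon>cs \<and>
     (\<forall>i. a $ i \<ge> 0 \<and> s $ i + a $ i * c x $ i \<ge> - \<epsilon>pd) \<and>
     (\<forall>w :: real^'n.
        (\<forall>i \<in> approx_active_set c x \<zeta>. grad (\<lambda>y. c y $ i) x \<bullet> w = 0) \<longrightarrow>
        w \<bullet> (hessian (lagrangian f c s) x *v w) \<ge> - \<epsilon>soc * (norm w)\<^sup>2)"

end

theory Submission
  imports Defs
begin

text \<open>
  Condition (iii) can only be exploited along pairs \<open>(w, z)\<close> with \<open>\<nabla>c\<^sub>i(x)\<^sup>T w = 2 v\<^sub>i z\<^sub>i\<close> for every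
  \<open>i\<close>. A constraint outside \<open>\<A>\<^sub>\<zeta>\<close> never obstructs the choice of such a pair: there
  \<open>v\<^sub>i\<^sup>2 \<ge> c\<^sub>i(x) - \<epsilon>\<^sub>2 \<ge> \<zeta> / 2\<close>, so \<open>z\<^sub>i\<close> can be solved for, with \<open>z\<^sub>i\<^sup>2 = O(\<parallel>w\<parallel>\<^sup>2 / \<zeta>)\<close>, and
  approximate stationarity in \<open>v\<close> makes the multiplier that weighs \<open>z\<^sub>i\<^sup>2\<close> small,
  \<open>\<bar>s\<^sub>i\<bar> \<le> \<epsilon>\<^sub>1 / \<zeta>\<^sup>1\<^sup>/\<^sup>2\<close>. The inactive constraints therefore cost only
  \<open>O(\<epsilon>\<^sub>3 / \<zeta> + \<epsilon>\<^sub>1 / \<zeta>\<^sup>3\<^sup>/\<^sup>2) \<parallel>w\<parallel>\<^sup>2\<close>, and only the active ones have to be prescribed; this is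
  \<open>curvature_from_active_slacks\<close>.

  Two choices on the active set give the two nontrivial conditions of (NLP). With \<open>z\<^sub>i = 0\<close> for all
  active \<open>i\<close> the vector \<open>w\<close> ranges over the approximate critical subspace, which is condition (e).
  With \<open>z\<close> a unit vector at one active index \<open>i\<close>, full row rank provides \<open>w = 2 v\<^sub>i u\<close>, where
  \<open>u\<close> is dual to \<open>\<nabla>c\<^sub>i(x)\<close> among the active gradients. The curvature inequality then bounds
  \<open>s\<^sub>i\<close> from below, and the Hessian term \<open>4 v\<^sub>i\<^sup>2 u\<^sup>T H u\<close> is where the summand \<open>a\<^sub>i c\<^sub>i(x)\<close> of
  condition (d) comes from, because \<open>v\<^sub>i\<^sup>2 \<le> c\<^sub>i(x) + \<epsilon>\<^sub>2\<close>. As \<open>i\<close> is active,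
  \<open>v\<^sub>i\<^sup>2 \<le> 3 \<zeta> / 2\<close>, which cancels one factor \<open>1 / \<zeta>\<close>; hence the milder dependence on \<open>\<zeta>\<close> in (d).

  The dual vectors depend on the active set, hence on \<open>\<zeta>\<close>. There are finitely many subsets of
  constraints, so their norms have a bound in terms of the Jacobian alone
  (\<open>dual_vectors_bounded\<close>). This makes \<open>a\<close> and the constants independent of the tolerances.
\<close>

section \<open>The gradient of the Lagrangian\<close>

lemma grad_eqI:
  fixes F :: "real^'n \<Rightarrow> real"
  assumes "GDERIV F x :> g"
  shows "grad F x = g"
proof -
  have "frechet_derivative F (at x) = (\<lambda>h. h \<bullet> g)"
    using assms unfolding gderiv_def by (rule frechet_derivative_at[symmetric])
  then show ?thesis
    by (simp add: grad_def vec_eq_iff inner_axis')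
qed

lemma grad_lagrangian:
  fixes f :: "real^'n \<Rightarrow> real" and c :: "real^'n \<Rightarrow> real^'m"
  assumes "f differentiable (at x)" "\<And>i. (\<lambda>y. c y $ i) differentiable (at x)"
  shows "grad (lagrangian f c s) x =
    grad f x - (\<Sum>i\<in>UNIV. s $ i *\<^sub>R grad (\<lambda>y. c y $ i) x)"
proof (rule grad_eqI)
  have f: "(f has_derivative (\<lambda>h. h \<bullet> grad f x)) (at x)"
    using GDERIV_grad[OF assms(1)] by (simp add: gderiv_def)
  have c: "((\<lambda>y. c y $ i) has_derivative (\<lambda>h. h \<bullet> grad (\<lambda>y. c y $ i) x)) (at x)" for i
    using GDERIV_grad[OF assms(2)] by (simp add: gderiv_def)
  have "(lagrangian f c s has_derivative
      (\<lambda>h. h \<bullet> grad f x - (\<Sum>i\<in>UNIV. s $ i * (h \<bullet> grad (\<lambda>y. c y $ i) x)))) (at x)"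
    unfolding lagrangian_def
    by (intro has_derivative_diff f has_derivative_sum has_derivative_mult_right c)
  then show "GDERIV (lagrangian f c s) x :>
      grad f x - (\<Sum>i\<in>UNIV. s $ i *\<^sub>R grad (\<lambda>y. c y $ i) x)"
    by (simp add: gderiv_def inner_diff_right inner_sum_right)
qed

lemma differentiable_vec_componentwise:
  fixes c :: "'a::real_normed_vector \<Rightarrow> real^'m"
  assumes "\<And>i. (\<lambda>y. c y $ i) differentiable (at x)"
  shows "c differentiable (at x)"
proof (subst differentiable_componentwise_within, intro ballI)
  fix b :: "real^'m"
  assume "b \<in> Basis"
  then obtain i where "b = axis i 1"
    by (auto simp: Basis_vec_def)
  then show "(\<lambda>y. c y \<bullet> b) differentiable (at x)"
    using assms[of i] by (simp add: inner_axis)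
qed

section \<open>Vectors dual to linearly independent rows\<close>

text \<open>
  The part of row \<open>i\<close> orthogonal to the span of the other rows in \<open>A\<close> is nonzero by independence;
  normalised, it is dual to row \<open>i\<close>.
\<close>

lemma full_row_rank_on_dual_vector:
  fixes J :: "real^'n^'m"
  assumes rank: "full_row_rank_on A J" and i: "i \<in> A"
  shows "\<exists>u. \<forall>j\<in>A. row j J \<bullet> u = (if j = i then 1 else 0)"
proof -
  let ?g = "\<lambda>j. row j J"
  let ?S = "?g ` (A - {i})"
  have not_in: "?g i \<notin> span ?S"
  proof
    assume "?g i \<in> span ?S"
    then have "?g ` A \<subseteq> span ?S"
      using span_superset[of ?S] by auto
    then have "dim (?g ` A) \<le> card ?S"
      by (intro dim_le_card) auto
    also have "\<dots> \<le> card (A - {i})"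
      by (rule card_image_le) simp
    also have "\<dots> < card A"
      using i by (intro psubset_card_mono) auto
    finally show False
      using rank by (simp add: full_row_rank_on_def)
  qed
  obtain y z where y: "y \<in> span ?S" and z: "\<And>w. w \<in> span ?S \<Longrightarrow> orthogonal z w"
    and split: "?g i = y + z"
    using orthogonal_subspace_decomp_exists[of ?S "?g i"] by metis
  have "z \<noteq> 0"
    using not_in y split by auto
  have "?g i \<bullet> z = z \<bullet> z"
    using z[OF y] split by (simp add: orthogonal_def inner_add_left inner_add_right inner_commute)
  moreover have "?g j \<bullet> z = 0" if "j \<in> A" "j \<noteq> i" for j
    using z[of "?g j"] that by (simp add: orthogonal_def inner_commute span_base)
  ultimately have "\<forall>j\<in>A. ?g j \<bullet> (z /\<^sub>R (z \<bullet> z)) = (if j = i then 1 else 0)"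
    using \<open>z \<noteq> 0\<close> by simp
  then show ?thesis ..
qed

text \<open>
  The bound is uniform in \<open>A\<close>, which varies with \<open>\<zeta>\<close>: summing over all pairs \<open>(A, i)\<close> suffices,
  since there are finitely many.
\<close>

lemma dual_vectors_bounded:
  fixes J :: "real^'n^'m"
  shows "\<exists>U. \<forall>A i. full_row_rank_on A J \<and> i \<in> A \<longrightarrow>
    (\<exists>u. norm u \<le> U \<and> (\<forall>j\<in>A. row j J \<bullet> u = (if j = i then 1 else 0)))"
proof -
  obtain u where u: "\<And>A i. full_row_rank_on A J \<Longrightarrow> i \<in> A \<Longrightarrow>
      \<forall>j\<in>A. row j J \<bullet> u A i = (if j = i then 1 else 0)"
    using full_row_rank_on_dual_vector[of _ J] by metis
  let ?U = "\<Sum>p\<in>UNIV. norm (u (fst p) (snd p))"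
  have bound: "norm (u A i) \<le> ?U" for A i
    using member_le_sum[of "(A, i)" UNIV "\<lambda>p. norm (u (fst p) (snd p))"] by simp
  have "\<exists>u. norm u \<le> ?U \<and> (\<forall>j\<in>A. row j J \<bullet> u = (if j = i then 1 else 0))"
    if "full_row_rank_on A J \<and> i \<in> A" for A i
    using bound[of A i] u[of A i] that by blast
  then show ?thesis
    by (intro exI[of _ ?U] allI impI)
qed

section \<open>Approximate second-order points of the squared-slack problem\<close>

text \<open>
  At a fixed \<open>x\<close>, an approximate 2N point of (SSV) is a matter of linear algebra: \<open>b\<close> stands for
  \<open>c(x)\<close>, \<open>J\<close> for the constraint Jacobian and \<open>H\<close> for the Hessian of the Lagrangian. Stationarity
  in \<open>x\<close> is the same condition for both problems, so the locale records stationarity in \<open>v\<close>.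
\<close>

locale slack_point =
  fixes b s v :: "real^'m" and J :: "real^'n^'m" and H :: "real^'n^'n"
    and \<epsilon>1 \<epsilon>2 \<epsilon>3 \<zeta> :: real
  assumes \<epsilon>1: "0 < \<epsilon>1" and \<epsilon>2: "0 < \<epsilon>2" "\<epsilon>2 \<le> 1" and \<epsilon>3: "0 < \<epsilon>3"
    and \<zeta>: "2 * \<epsilon>2 \<le> \<zeta>"
    and stationary: "norm (2 *\<^sub>R (s * v)) \<le> \<epsilon>1"
    and feasible: "norm (b - v * v) \<le> \<epsilon>2"
    and curvature: "\<And>w z. (\<And>i. row i J \<bullet> w = 2 * v $ i * z $ i) \<Longrightarrow>
      w \<bullet> (H *v w) + 2 * (\<Sum>i\<in>UNIV. s $ i * (z $ i)\<^sup>2) \<ge> - \<epsilon>3 * (norm (w, z))\<^sup>2"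
begin

abbreviation active :: "'m set" where "active \<equiv> {i. b $ i \<le> \<zeta>}"

abbreviation frobenius_sq :: real where "frobenius_sq \<equiv> \<Sum>i\<in>UNIV. (norm (row i J))\<^sup>2"

lemma \<zeta>_pos: "0 < \<zeta>"
  using \<epsilon>2 \<zeta> by linarith

lemma slack_close: "\<bar>b $ i - (v $ i)\<^sup>2\<bar> \<le> \<epsilon>2"
  using component_le_norm_cart[of "b - v * v" i] feasible by (simp add: power2_eq_square)

lemma constraint_ge: "- \<epsilon>2 \<le> b $ i"
  using slack_close[of i] zero_le_power2[of "v $ i"] by linarith

lemma slack_le: "(v $ i)\<^sup>2 \<le> norm b + 1"
  using slack_close[of i] component_le_norm_cart[of b i] \<epsilon>2 by linarith

lemma multiplier_slack: "2 * \<bar>s $ i * v $ i\<bar> \<le> \<epsilon>1"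
  using component_le_norm_cart[of "2 *\<^sub>R (s * v)" i] stationary by (simp add: abs_mult)

lemma inactive_slack:
  assumes "i \<notin> active"
  shows "\<zeta> / 2 \<le> (v $ i)\<^sup>2"
  using assms slack_close[of i] \<zeta> by simp

lemma inactive_multiplier:
  assumes "i \<notin> active"
  shows "\<bar>s $ i\<bar> \<le> \<epsilon>1 / sqrt \<zeta>"
proof -
  have "sqrt \<zeta> \<le> sqrt (4 * (v $ i)\<^sup>2)"
    using inactive_slack[OF assms] \<zeta>_pos by (intro real_sqrt_le_mono) linarith
  also have "\<dots> = 2 * \<bar>v $ i\<bar>"
    by (simp add: real_sqrt_mult)
  finally have "\<bar>s $ i\<bar> * sqrt \<zeta> \<le> \<bar>s $ i\<bar> * (2 * \<bar>v $ i\<bar>)"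
    by (rule mult_left_mono) simp
  also have "\<dots> \<le> \<epsilon>1"
    using multiplier_slack[of i] by (simp add: abs_mult)
  finally show ?thesis
    using \<zeta>_pos by (simp add: pos_le_divide_eq)
qed

text \<open>
  Split \<open>b\<close> into the infeasibility \<open>b - v * v\<close>, which is \<open>O(\<epsilon>2)\<close>, and \<open>v * v\<close>, for which \<open>s * v\<close>
  is \<open>O(\<epsilon>1)\<close> and the entries of the other factor \<open>v\<close> are controlled by \<open>b\<close>.
\<close>

lemma complementarity: "norm (s * b) \<le> (norm s + norm b + 1) * (\<epsilon>1 + \<epsilon>2)"
proof -
  have v: "\<bar>v $ i\<bar> \<le> norm b + 1" for i
  proof (rule abs_le_square_iff[THEN iffD2, of _ "norm b + 1", simplified])
    have "(v $ i)\<^sup>2 \<le> norm b + 1"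
      by (rule slack_le)
    also have "\<dots> \<le> (norm b + 1)\<^sup>2"
      using self_le_power[of "norm b + 1" 2] by simp
    finally show "(v $ i)\<^sup>2 \<le> (norm b + 1)\<^sup>2" .
  qed
  have "norm (s * (b - v * v)) \<le> norm (norm s *\<^sub>R (b - v * v))"
    by (rule norm_le_componentwise_cart)
       (simp add: abs_mult mult_right_mono component_le_norm_cart)
  also have "\<dots> \<le> norm s * \<epsilon>2"
    using feasible by (simp add: mult_left_mono)
  finally have infeasible_part: "norm (s * (b - v * v)) \<le> norm s * \<epsilon>2" .
  have "norm (s * v * v) \<le> norm ((norm b + 1) *\<^sub>R (s * v))"
  proof (rule norm_le_componentwise_cart)
    fix i
    have "\<bar>s $ i * v $ i\<bar> * \<bar>v $ i\<bar> \<le> \<bar>s $ i * v $ i\<bar> * (norm b + 1)"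
      by (intro mult_left_mono v) simp
    then show "norm ((s * v * v) $ i) \<le> norm (((norm b + 1) *\<^sub>R (s * v)) $ i)"
      by (simp add: abs_mult mult_ac)
  qed
  also have "\<dots> = (norm b + 1) * norm (s * v)"
    by simp
  also have "\<dots> \<le> (norm b + 1) * \<epsilon>1"
  proof (rule mult_left_mono)
    show "norm (s * v) \<le> \<epsilon>1"
      using stationary norm_ge_zero[of "s * v"] unfolding norm_scaleR by linarith
  qed simp
  finally have slack_part: "norm (s * v * v) \<le> (norm b + 1) * \<epsilon>1" .
  have "norm (s * b) \<le> norm (s * (b - v * v)) + norm (s * v * v)"
    using norm_triangle_ineq[of "s * (b - v * v)" "s * v * v"] by (simp add: algebra_simps)
  also have "\<dots> \<le> norm s * \<epsilon>2 + (norm b + 1) * \<epsilon>1"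
    using infeasible_part slack_part by linarith
  also have "\<dots> \<le> (norm s + norm b + 1) * \<epsilon>2 + (norm s + norm b + 1) * \<epsilon>1"
    using \<epsilon>1 \<epsilon>2 by (intro add_mono mult_right_mono) auto
  finally show ?thesis
    by (simp add: algebra_simps)
qed

text \<open>
  Active slack directions \<open>t\<close> that match \<open>w\<close> extend to all indices by solving the inactive
  equations for \<open>z\<close>; the last term and the last summand of the \<open>\<epsilon>3\<close>-term bound what this extension
  contributes.
\<close>

lemma curvature_from_active_slacks:
  assumes "\<And>i. i \<in> active \<Longrightarrow> row i J \<bullet> w = 2 * v $ i * t i"
  shows "w \<bullet> (H *v w) + 2 * (\<Sum>i\<in>active. s $ i * (t i)\<^sup>2) \<ge>
    - \<epsilon>3 * ((norm w)\<^sup>2 + (\<Sum>i\<in>active. (t i)\<^sup>2) + frobenius_sq * (norm w)\<^sup>2 / (2 * \<zeta>))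
    - \<epsilon>1 / sqrt \<zeta> * (frobenius_sq * (norm w)\<^sup>2 / \<zeta>)"
proof -
  define z :: "real^'m" where
    "z = (\<chi> i. if i \<in> active then t i else (row i J \<bullet> w) / (2 * v $ i))"
  define R where "R = (\<Sum>i\<in>-active. (z $ i)\<^sup>2)"
  have split: "(\<Sum>i\<in>UNIV. h i) = (\<Sum>i\<in>active. h i) + (\<Sum>i\<in>-active. h i)" for h :: "'m \<Rightarrow> real"
    by (subst sum.union_disjoint[symmetric]) auto
  have v0: "v $ i \<noteq> 0" if "i \<notin> active" for i
    using inactive_slack[OF that] \<zeta>_pos by auto
  have "row i J \<bullet> w = 2 * v $ i * z $ i" for i
    using assms[of i] v0[of i] by (auto simp: z_def)
  from curvature[OF this]
  have curv: "- \<epsilon>3 * (norm (w, z))\<^sup>2 \<le> w \<bullet> (H *v w) + 2 * (\<Sum>i\<in>UNIV. s $ i * (z $ i)\<^sup>2)" .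
  have "(norm (w, z))\<^sup>2 = (norm w)\<^sup>2 + (\<Sum>i\<in>UNIV. (z $ i)\<^sup>2)"
    by (simp add: norm_Pair norm_vec_def L2_set_def sum_nonneg)
  also have "\<dots> = (norm w)\<^sup>2 + (\<Sum>i\<in>active. (t i)\<^sup>2) + R"
    unfolding split R_def by (simp add: z_def)
  finally have norm: "(norm (w, z))\<^sup>2 = (norm w)\<^sup>2 + (\<Sum>i\<in>active. (t i)\<^sup>2) + R" .
  have "(z $ i)\<^sup>2 \<le> (norm (row i J))\<^sup>2 * ((norm w)\<^sup>2 / (2 * \<zeta>))" if i: "i \<notin> active" for i
  proof -
    have "(z $ i)\<^sup>2 = (row i J \<bullet> w)\<^sup>2 / (4 * (v $ i)\<^sup>2)"
      using i by (simp add: z_def power_divide power_mult_distrib)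
    also have "\<dots> \<le> (norm (row i J) * norm w)\<^sup>2 / (2 * \<zeta>)"
      using inactive_slack[OF i] \<zeta>_pos Cauchy_Schwarz_ineq2[of "row i J" w]
      by (intro frac_le) (auto simp: abs_le_square_iff[symmetric] abs_mult)
    finally show ?thesis
      by (simp add: power_mult_distrib)
  qed
  then have "R \<le> (\<Sum>i\<in>-active. (norm (row i J))\<^sup>2 * ((norm w)\<^sup>2 / (2 * \<zeta>)))"
    unfolding R_def by (intro sum_mono) auto
  also have "\<dots> \<le> (\<Sum>i\<in>UNIV. (norm (row i J))\<^sup>2 * ((norm w)\<^sup>2 / (2 * \<zeta>)))"
    using \<zeta>_pos by (intro sum_mono2) auto
  finally have R: "R \<le> frobenius_sq * (norm w)\<^sup>2 / (2 * \<zeta>)"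
    by (simp add: sum_distrib_right sum_divide_distrib)
  have "(\<Sum>i\<in>-active. s $ i * (z $ i)\<^sup>2) \<le> (\<Sum>i\<in>-active. \<epsilon>1 / sqrt \<zeta> * (z $ i)\<^sup>2)"
    using inactive_multiplier by (intro sum_mono mult_right_mono) (auto simp: abs_le_iff)
  also have "\<dots> = \<epsilon>1 / sqrt \<zeta> * R"
    by (simp add: R_def sum_distrib_left)
  also have "\<dots> \<le> \<epsilon>1 / sqrt \<zeta> * (frobenius_sq * (norm w)\<^sup>2 / (2 * \<zeta>))"
    using R \<epsilon>1 \<zeta>_pos by (intro mult_left_mono) auto
  finally have "2 * (\<Sum>i\<in>-active. s $ i * (z $ i)\<^sup>2) \<le>
      2 * (\<epsilon>1 / sqrt \<zeta> * (frobenius_sq * (norm w)\<^sup>2 / (2 * \<zeta>)))"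
    by (rule mult_left_mono) simp
  also have "\<dots> = \<epsilon>1 / sqrt \<zeta> * (frobenius_sq * (norm w)\<^sup>2 / \<zeta>)"
    by simp
  finally have inactive_sum: "2 * (\<Sum>i\<in>-active. s $ i * (z $ i)\<^sup>2) \<le>
      \<epsilon>1 / sqrt \<zeta> * (frobenius_sq * (norm w)\<^sup>2 / \<zeta>)" .
  have active_sum: "(\<Sum>i\<in>UNIV. s $ i * (z $ i)\<^sup>2) =
      (\<Sum>i\<in>active. s $ i * (t i)\<^sup>2) + (\<Sum>i\<in>-active. s $ i * (z $ i)\<^sup>2)"
    unfolding split by (simp add: z_def)
  have "\<epsilon>3 * R \<le> \<epsilon>3 * (frobenius_sq * (norm w)\<^sup>2 / (2 * \<zeta>))"
    using R \<epsilon>3 by (intro mult_left_mono) auto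
  then show ?thesis
    using curv inactive_sum unfolding norm active_sum by (simp add: algebra_simps)
qed

lemma curvature_on_critical_subspace:
  assumes "\<And>i. i \<in> active \<Longrightarrow> row i J \<bullet> w = 0"
  shows "w \<bullet> (H *v w) \<ge>
    - ((1 + frobenius_sq) * (\<epsilon>3 + \<epsilon>3 / \<zeta> + \<epsilon>1 / (\<zeta> * sqrt \<zeta>))) * (norm w)\<^sup>2"
proof -
  let ?n = "(norm w)\<^sup>2" and ?e = "\<epsilon>1 / (\<zeta> * sqrt \<zeta>)"
  have G: "0 \<le> frobenius_sq"
    by (simp add: sum_nonneg)
  have pos: "0 \<le> \<epsilon>3 / \<zeta>" "0 \<le> ?e"
    using \<epsilon>1 \<epsilon>3 \<zeta>_pos by auto
  have "\<epsilon>3 * (?n + frobenius_sq * ?n / (2 * \<zeta>)) + \<epsilon>1 / sqrt \<zeta> * (frobenius_sq * ?n / \<zeta>)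
      = (\<epsilon>3 + frobenius_sq * (\<epsilon>3 / \<zeta>) / 2 + frobenius_sq * ?e) * ?n"
    by (simp add: algebra_simps)
  also have "\<dots> \<le> ((1 + frobenius_sq) * (\<epsilon>3 + \<epsilon>3 / \<zeta> + ?e)) * ?n"
  proof (rule mult_right_mono)
    have "e + g * d / 2 + g * k \<le> (1 + g) * (e + d + k)"
      if "0 \<le> e" "0 \<le> g" "0 \<le> d" "0 \<le> k" for e g d k :: real
      using that mult_nonneg_nonneg[of g e] mult_nonneg_nonneg[of g d] by (simp add: algebra_simps)
    then show "\<epsilon>3 + frobenius_sq * (\<epsilon>3 / \<zeta>) / 2 + frobenius_sq * ?e
        \<le> (1 + frobenius_sq) * (\<epsilon>3 + \<epsilon>3 / \<zeta> + ?e)"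
      using \<epsilon>3 G pos by (meson less_imp_le)
  qed simp
  finally have "- ((1 + frobenius_sq) * (\<epsilon>3 + \<epsilon>3 / \<zeta> + ?e)) * ?n
      \<le> - (\<epsilon>3 * (?n + frobenius_sq * ?n / (2 * \<zeta>)) + \<epsilon>1 / sqrt \<zeta> * (frobenius_sq * ?n / \<zeta>))"
    by (simp only: mult_minus_left neg_le_iff_le)
  also have "\<dots> \<le> w \<bullet> (H *v w)"
    using curvature_from_active_slacks[of w "\<lambda>_. 0"] assms by simp
  finally show ?thesis .
qed

text \<open>
  The test direction is the dual vector \<open>u\<close> scaled to match a unit slack direction at \<open>i\<close>. The
  constraint value enters through \<open>(v $ i)\<^sup>2 \<le> b $ i + \<epsilon>2\<close>, applied to the Hessian term only.
\<close>

lemma active_multiplier: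
  assumes i: "i \<in> active" and U: "norm u \<le> U"
    and dual: "\<forall>j\<in>active. row j J \<bullet> u = (if j = i then 1 else 0)"
  shows "s $ i + 2 * onorm ((*v) H) * U\<^sup>2 * b $ i \<ge>
    - ((1 + (2 * onorm ((*v) H) + 2 * (norm b + 1) + 3 * frobenius_sq) * U\<^sup>2) *
       (\<epsilon>1 / sqrt \<zeta> + \<epsilon>2 + \<epsilon>3))"
proof -
  define w where "w = (2 * v $ i) *\<^sub>R u"
  define t :: "'m \<Rightarrow> real" where "t j = (if j = i then 1 else 0)" for j
  define p where "p = (v $ i)\<^sup>2"
  define e where "e = \<epsilon>1 / sqrt \<zeta>"
  define N where "N = onorm ((*v) H)"
  define P where "P = 2 * N * U\<^sup>2"
  define Q where "Q = 2 * (norm b + 1) * U\<^sup>2"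
  define S where "S = 3 * frobenius_sq * U\<^sup>2"
  have bl: "bounded_linear ((*v) H)"
    by (rule matrix_vector_mul_bounded_linear)
  have N: "0 \<le> N"
    unfolding N_def by (rule onorm_pos_le[OF bl])
  have G: "0 \<le> frobenius_sq"
    by (simp add: sum_nonneg)
  have e: "0 \<le> e"
    using \<epsilon>1 \<zeta>_pos by (simp add: e_def)
  have PQS: "0 \<le> P" "0 \<le> Q" "0 \<le> S"
    using N G by (auto simp: P_def Q_def S_def)
  have p: "0 \<le> p" "p \<le> b $ i + \<epsilon>2" "p \<le> norm b + 1" "4 * p \<le> 6 * \<zeta>"
    using slack_close[of i] slack_le[of i] i \<zeta> by (auto simp: p_def)
  have "(norm u)\<^sup>2 \<le> U\<^sup>2"
    using U by (intro power_mono) auto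
  then have w: "(norm w)\<^sup>2 \<le> 4 * p * U\<^sup>2"
    using p(1) by (simp add: w_def p_def power_mult_distrib mult_left_mono)
  have "w \<bullet> (H *v w) \<le> norm w * norm (H *v w)"
    by (rule norm_cauchy_schwarz)
  also have "\<dots> \<le> norm w * (N * norm w)"
    unfolding N_def by (intro mult_left_mono onorm[OF bl]) simp
  also have "\<dots> = N * (norm w)\<^sup>2"
    by (simp add: power2_eq_square)
  also have "\<dots> \<le> N * (4 * p * U\<^sup>2)"
    using w N by (rule mult_left_mono)
  also have "\<dots> = 2 * (P * p)"
    by (simp add: P_def)
  also have "\<dots> \<le> 2 * (P * (b $ i + \<epsilon>2))"
    using p(2) PQS(1) by (intro mult_left_mono) auto
  finally have hess: "w \<bullet> (H *v w) \<le> 2 * (P * (b $ i + \<epsilon>2))" .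
  have "4 * p * U\<^sup>2 \<le> 4 * (norm b + 1) * U\<^sup>2"
    using p(3) by (intro mult_right_mono) auto
  then have wQ: "(norm w)\<^sup>2 \<le> 2 * Q"
    using w unfolding Q_def by linarith
  \<comment> \<open>As \<open>i\<close> is active, \<open>w\<close> has norm \<open>O(\<surd>\<zeta>)\<close>; this absorbs the division by \<open>\<zeta>\<close> in the cost of the
    inactive slacks.\<close>
  have "(norm w)\<^sup>2 \<le> 6 * \<zeta> * U\<^sup>2"
    using w mult_right_mono[OF p(4), of "U\<^sup>2"] by simp
  then have "frobenius_sq * (norm w)\<^sup>2 \<le> frobenius_sq * (6 * \<zeta> * U\<^sup>2)"
    using G by (rule mult_left_mono)
  then have wS: "frobenius_sq * (norm w)\<^sup>2 / \<zeta> \<le> 2 * S"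
    using \<zeta>_pos by (simp add: S_def pos_divide_le_eq algebra_simps)
  have wS2: "frobenius_sq * (norm w)\<^sup>2 / (2 * \<zeta>) \<le> S"
    using wS \<zeta>_pos by (simp add: pos_divide_le_eq mult_ac)
  have sums: "(\<Sum>j\<in>active. s $ j * (t j)\<^sup>2) = s $ i" "(\<Sum>j\<in>active. (t j)\<^sup>2) = 1"
    using i by (simp_all add: t_def if_distrib[of "\<lambda>r. r\<^sup>2"] if_distrib[of "(*) _"] cong: if_cong)
  have "row j J \<bullet> w = 2 * v $ j * t j" if "j \<in> active" for j
    using dual that by (simp add: w_def t_def)
  from curvature_from_active_slacks[OF this]
  have "- \<epsilon>3 * ((norm w)\<^sup>2 + 1 + frobenius_sq * (norm w)\<^sup>2 / (2 * \<zeta>))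
      - e * (frobenius_sq * (norm w)\<^sup>2 / \<zeta>) \<le> w \<bullet> (H *v w) + 2 * s $ i"
    unfolding sums e_def .
  moreover have "\<epsilon>3 * ((norm w)\<^sup>2 + 1 + frobenius_sq * (norm w)\<^sup>2 / (2 * \<zeta>)) \<le> \<epsilon>3 * (2 * Q + 1 + S)"
    using wQ wS2 \<epsilon>3 by (intro mult_left_mono) auto
  moreover have "e * (frobenius_sq * (norm w)\<^sup>2 / \<zeta>) \<le> e * (2 * S)"
    using wS e by (rule mult_left_mono)
  ultimately have "- (\<epsilon>3 * (2 * Q + 1 + S)) - e * (2 * S) \<le> 2 * (P * (b $ i + \<epsilon>2)) + 2 * s $ i"
    using hess by linarith
  moreover have "0 \<le> P * e" "0 \<le> P * \<epsilon>3" "0 \<le> Q * e" "0 \<le> Q * \<epsilon>2" "0 \<le> S * \<epsilon>2" "0 \<le> S * \<epsilon>3"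
    using PQS e \<epsilon>2 \<epsilon>3 by simp_all
  ultimately have "- ((1 + P + Q + S) * (e + \<epsilon>2 + \<epsilon>3)) \<le> s $ i + P * b $ i"
    using e \<epsilon>2 \<epsilon>3 by (simp add: algebra_simps)
  moreover have "1 + P + Q + S = 1 + (2 * N + 2 * (norm b + 1) + 3 * frobenius_sq) * U\<^sup>2"
    by (simp add: P_def Q_def S_def algebra_simps)
  ultimately show ?thesis
    by (simp only: P_def N_def e_def)
qed

end

section \<open>From the squared-slack problem to the nonlinear program\<close>

theorem theorem3p6:
  shows "\<exists>(Kcs :: real^'m \<Rightarrow> real^'n^'m \<Rightarrow> real^'m \<Rightarrow> real^'n^'n \<Rightarrow> real)
          (Kpd :: real^'m \<Rightarrow> real^'n^'m \<Rightarrow> real^'m \<Rightarrow> real^'n^'n \<Rightarrow> real)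
          (Ksoc :: real^'m \<Rightarrow> real^'n^'m \<Rightarrow> real^'m \<Rightarrow> real^'n^'n \<Rightarrow> real).
    \<forall>(f :: real^'n \<Rightarrow> real) (c :: real^'n \<Rightarrow> real^'m) (x :: real^'n) (s :: real^'m).
      twice_continuously_differentiable f \<and>
      (\<forall>i. twice_continuously_differentiable (\<lambda>y. c y $ i)) \<longrightarrow>
      (\<exists>a :: real^'m.
        \<forall>(v :: real^'m) (\<epsilon>1 :: real) (\<epsilon>2 :: real) (\<epsilon>3 :: real) (\<zeta> :: real).
          \<epsilon>1 \<in> {0<..1} \<and> \<epsilon>2 \<in> {0<..1} \<and> \<epsilon>3 \<in> {0<..1} \<and>
          SSV_approx_2N_point f c x v s \<epsilon>1 \<epsilon>2 \<epsilon>3 \<and>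
          \<zeta> \<ge> 2 * \<epsilon>2 \<and>
          full_row_rank_on (approx_active_set c x \<zeta>) (jacobian c (at x)) \<longrightarrow>
          (\<exists>\<epsilon>foc \<epsilon>pf \<epsilon>cs \<epsilon>pd \<epsilon>soc :: real.
            \<epsilon>foc > 0 \<and> \<epsilon>pf > 0 \<and> \<epsilon>cs > 0 \<and> \<epsilon>pd > 0 \<and> \<epsilon>soc > 0 \<and>
            \<epsilon>foc = \<epsilon>1 \<and>
            \<epsilon>pf = \<epsilon>2 \<and>
            \<epsilon>cs \<le> Kcs (c x) (jacobian c (at x)) s (hessian (lagrangian f c s) x)
                    * (\<epsilon>1 + \<epsilon>2) \<and>
            \<epsilon>pd \<le> Kpd (c x) (jacobian c (at x)) s (hessian (lagrangian f c s) x)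
                    * (\<epsilon>1 / \<zeta> powr (1/2) + \<epsilon>2 + \<epsilon>3) \<and>
            \<epsilon>soc \<le> Ksoc (c x) (jacobian c (at x)) s (hessian (lagrangian f c s) x)
                    * (\<epsilon>3 + \<epsilon>3 / \<zeta> + \<epsilon>1 / \<zeta> powr (3/2)) \<and>
            NLP_approx_2N_point f c a x s \<epsilon>foc \<epsilon>pf \<epsilon>cs \<epsilon>pd \<epsilon>soc \<zeta>))"
proof -
  have "\<forall>J :: real^'n^'m. \<exists>U. \<forall>A i. full_row_rank_on A J \<and> i \<in> A \<longrightarrow>
      (\<exists>u. norm u \<le> U \<and> (\<forall>j\<in>A. row j J \<bullet> u = (if j = i then 1 else 0)))"
    using dual_vectors_bounded by blast
  then obtain U :: "real^'n^'m \<Rightarrow> real" where "\<forall>J A i. full_row_rank_on A J \<and> i \<in> A \<longrightarrow>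
      (\<exists>u. norm u \<le> U J \<and> (\<forall>j\<in>A. row j J \<bullet> u = (if j = i then 1 else 0)))"
    by (rule exE[OF choice])
  then have U: "\<exists>u. norm u \<le> U J \<and> (\<forall>j\<in>A. row j J \<bullet> u = (if j = i then 1 else 0))"
    if "full_row_rank_on A J" "i \<in> A" for J A i
    using that by blast
  define G where "G = (\<lambda>J :: real^'n^'m. \<Sum>i\<in>UNIV. (norm (row i J))\<^sup>2)"
  define N where "N = (\<lambda>H :: real^'n^'n. onorm ((*v) H))"
  define Kcs where "Kcs = (\<lambda>(b :: real^'m) (J :: real^'n^'m) (s :: real^'m) (H :: real^'n^'n).
      norm s + norm b + 1)"
  define Kpd where "Kpd = (\<lambda>(b :: real^'m) (J :: real^'n^'m) (s :: real^'m) (H :: real^'n^'n).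
      1 + (2 * N H + 2 * (norm b + 1) + 3 * G J) * (U J)\<^sup>2)"
  define Ksoc where "Ksoc = (\<lambda>(b :: real^'m) (J :: real^'n^'m) (s :: real^'m) (H :: real^'n^'n).
      1 + G J)"
  have G0: "0 \<le> G J" for J
    by (simp add: G_def sum_nonneg)
  have N0: "0 \<le> N H" for H
    unfolding N_def by (rule onorm_pos_le[OF matrix_vector_mul_bounded_linear])
  have Kcs1: "1 \<le> Kcs b J s H" and Kpd1: "1 \<le> Kpd b J s H" and Ksoc1: "1 \<le> Ksoc b J s H" for b J s H
    using G0[of J] N0[of H] by (auto simp: Kcs_def Kpd_def Ksoc_def)
  show ?thesis
  proof (rule exI[of _ Kcs], rule exI[of _ Kpd], rule exI[of _ Ksoc], intro allI impI)
    fix f :: "real^'n \<Rightarrow> real" and c :: "real^'n \<Rightarrow> real^'m" and x :: "real^'n" and s :: "real^'m"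
    assume smooth: "twice_continuously_differentiable f \<and>
      (\<forall>i. twice_continuously_differentiable (\<lambda>y. c y $ i))"
    define b where "b = c x"
    define J where "J = jacobian c (at x)"
    define H where "H = hessian (lagrangian f c s) x"
    have c_diff: "(\<lambda>y. c y $ i) differentiable (at x)" for i
      using smooth by (simp add: twice_continuously_differentiable_def)
    have grad_c: "grad (\<lambda>y. c y $ i) x = row i J" for i
      unfolding J_def using row_jacobian[OF differentiable_vec_componentwise[OF c_diff]] by simp
    have grad_L: "grad (lagrangian f c s) x =
        grad f x - (\<Sum>i\<in>UNIV. s $ i *\<^sub>R grad (\<lambda>y. c y $ i) x)"
      using smooth c_diff by (intro grad_lagrangian) (auto simp: twice_continuously_differentiable_def)
    \<comment> \<open>Twice a bound for \<open>\<bar>u\<^sup>T H u\<bar>\<close> over dual vectors \<open>u\<close> of norm at most \<open>U J\<close>. The same value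
      works at inactive indices because \<open>c\<^sub>i(x) > 0\<close> there.\<close>
    define a :: "real^'m" where "a = (\<chi> i. 2 * N H * (U J)\<^sup>2)"
    have a0: "0 \<le> a $ i" for i
      using N0[of H] by (simp add: a_def)
    show "\<exists>a. \<forall>v \<epsilon>1 \<epsilon>2 \<epsilon>3 \<zeta>.
          \<epsilon>1 \<in> {0<..1} \<and> \<epsilon>2 \<in> {0<..1} \<and> \<epsilon>3 \<in> {0<..1} \<and>
          SSV_approx_2N_point f c x v s \<epsilon>1 \<epsilon>2 \<epsilon>3 \<and>
          \<zeta> \<ge> 2 * \<epsilon>2 \<and>
          full_row_rank_on (approx_active_set c x \<zeta>) (jacobian c (at x)) \<longrightarrow>
          (\<exists>\<epsilon>foc \<epsilon>pf \<epsilon>cs \<epsilon>pd \<epsilon>soc.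
            \<epsilon>foc > 0 \<and> \<epsilon>pf > 0 \<and> \<epsilon>cs > 0 \<and> \<epsilon>pd > 0 \<and> \<epsilon>soc > 0 \<and>
            \<epsilon>foc = \<epsilon>1 \<and>
            \<epsilon>pf = \<epsilon>2 \<and>
            \<epsilon>cs \<le> Kcs (c x) (jacobian c (at x)) s (hessian (lagrangian f c s) x) * (\<epsilon>1 + \<epsilon>2) \<and>
            \<epsilon>pd \<le> Kpd (c x) (jacobian c (at x)) s (hessian (lagrangian f c s) x)
                    * (\<epsilon>1 / \<zeta> powr (1/2) + \<epsilon>2 + \<epsilon>3) \<and>
            \<epsilon>soc \<le> Ksoc (c x) (jacobian c (at x)) s (hessian (lagrangian f c s) x)
                    * (\<epsilon>3 + \<epsilon>3 / \<zeta> + \<epsilon>1 / \<zeta> powr (3/2)) \<and>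
            NLP_approx_2N_point f c a x s \<epsilon>foc \<epsilon>pf \<epsilon>cs \<epsilon>pd \<epsilon>soc \<zeta>)"
      unfolding b_def[symmetric] J_def[symmetric] H_def[symmetric]
    proof (rule exI[of _ a], intro allI impI)
      fix v :: "real^'m" and \<epsilon>1 \<epsilon>2 \<epsilon>3 \<zeta> :: real
      assume "\<epsilon>1 \<in> {0<..1} \<and> \<epsilon>2 \<in> {0<..1} \<and> \<epsilon>3 \<in> {0<..1} \<and>
          SSV_approx_2N_point f c x v s \<epsilon>1 \<epsilon>2 \<epsilon>3 \<and> \<zeta> \<ge> 2 * \<epsilon>2 \<and>
          full_row_rank_on (approx_active_set c x \<zeta>) J"
      then have eps: "0 < \<epsilon>1" "0 < \<epsilon>2" "\<epsilon>2 \<le> 1" "0 < \<epsilon>3" and \<zeta>: "2 * \<epsilon>2 \<le> \<zeta>"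
        and ssv: "SSV_approx_2N_point f c x v s \<epsilon>1 \<epsilon>2 \<epsilon>3"
        and rank: "full_row_rank_on (approx_active_set c x \<zeta>) J"
        by auto
      note ssv' = ssv[unfolded SSV_approx_2N_point_def,
          folded grad_L b_def H_def, unfolded grad_c]
      have stat: "norm (grad (lagrangian f c s) x, 2 *\<^sub>R (s * v)) \<le> \<epsilon>1"
        using ssv' by (rule conjunct1)
      have feas: "norm (b - v * v) \<le> \<epsilon>2"
        using ssv'[THEN conjunct2] by (rule conjunct1)
      have curv: "\<forall>w z. (\<forall>i. row i J \<bullet> w = 2 * v $ i * z $ i) \<longrightarrow>
          w \<bullet> (H *v w) + 2 * (\<Sum>i\<in>UNIV. s $ i * (z $ i)\<^sup>2) \<ge> - \<epsilon>3 * (norm (w, z))\<^sup>2"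
        using ssv'[THEN conjunct2] by (rule conjunct2)
      interpret slack_point b s v J H \<epsilon>1 \<epsilon>2 \<epsilon>3 \<zeta>
      proof
        show "norm (2 *\<^sub>R (s * v)) \<le> \<epsilon>1"
          by (rule order_trans[OF norm_snd_le stat])
        show "norm (b - v * v) \<le> \<epsilon>2"
          by (rule feas)
        show "w \<bullet> (H *v w) + 2 * (\<Sum>i\<in>UNIV. s $ i * (z $ i)\<^sup>2) \<ge> - \<epsilon>3 * (norm (w, z))\<^sup>2"
          if "\<And>i. row i J \<bullet> w = 2 * v $ i * z $ i" for w z
          using curv that by simp
      qed (use eps \<zeta> in auto)
      have act: "approx_active_set c x \<zeta> = active"
        by (simp add: approx_active_set_def b_def)
      have powr: "\<zeta> powr (1/2) = sqrt \<zeta>" "\<zeta> powr (3/2) = \<zeta> * sqrt \<zeta>"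
        using \<zeta>_pos powr_add[of \<zeta> 1 "1/2"] by (simp_all add: powr_half_sqrt)
      let ?cs = "Kcs b J s H * (\<epsilon>1 + \<epsilon>2)"
      let ?pd = "Kpd b J s H * (\<epsilon>1 / sqrt \<zeta> + \<epsilon>2 + \<epsilon>3)"
      let ?soc = "Ksoc b J s H * (\<epsilon>3 + \<epsilon>3 / \<zeta> + \<epsilon>1 / (\<zeta> * sqrt \<zeta>))"
      have small: "0 < \<epsilon>1 / sqrt \<zeta>" "0 < \<epsilon>3 / \<zeta>" "0 < \<epsilon>1 / (\<zeta> * sqrt \<zeta>)"
        using eps \<zeta>_pos by simp_all
      have K_pos: "0 < Kcs b J s H" "0 < Kpd b J s H" "0 < Ksoc b J s H"
        using Kcs1[of b J s H] Kpd1[of b J s H] Ksoc1[of b J s H] by linarith+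
      have pos: "0 < ?cs" "0 < ?pd" "0 < ?soc"
        using K_pos small eps by (auto intro!: mult_pos_pos add_pos_pos)
      have pd: "s $ i + a $ i * b $ i \<ge> - ?pd" for i
      proof (cases "i \<in> active")
        case True
        obtain u where "norm u \<le> U J" "\<forall>j\<in>active. row j J \<bullet> u = (if j = i then 1 else 0)"
          using U[OF rank[unfolded act] True] by blast
        from active_multiplier[OF True this] show ?thesis
          by (simp add: a_def Kpd_def N_def G_def)
      next
        case False
        have "\<bar>s $ i\<bar> \<le> \<epsilon>1 / sqrt \<zeta> + (\<epsilon>2 + \<epsilon>3)"
          using inactive_multiplier[OF False] eps by (intro add_increasing2) auto
        also have "\<dots> = 1 * (\<epsilon>1 / sqrt \<zeta> + \<epsilon>2 + \<epsilon>3)"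
          by simp
        also have "\<dots> \<le> ?pd"
          using small eps by (intro mult_right_mono Kpd1) auto
        finally have "- ?pd \<le> s $ i"
          by (simp only: abs_le_iff minus_le_iff)
        moreover have "0 \<le> a $ i * b $ i"
          using a0 False \<zeta>_pos by (intro mult_nonneg_nonneg) auto
        ultimately show ?thesis
          by (intro add_increasing2)
      qed
      have nlp: "NLP_approx_2N_point f c a x s \<epsilon>1 \<epsilon>2 ?cs ?pd ?soc \<zeta>"
        unfolding NLP_approx_2N_point_def grad_c act b_def[symmetric] H_def[symmetric]
      proof (intro conjI allI impI)
        show "norm (grad (lagrangian f c s) x) \<le> \<epsilon>1"
          by (rule order_trans[OF norm_fst_le stat])
        show "norm (s * b) \<le> ?cs"
          using complementarity by (simp add: Kcs_def)
        show "w \<bullet> (H *v w) \<ge> - ?soc * (norm w)\<^sup>2" if "\<forall>i\<in>active. row i J \<bullet> w = 0" for w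
          using curvature_on_critical_subspace[of w] that by (simp add: Ksoc_def G_def)
      qed (use constraint_ge a0 pd in auto)
      show "\<exists>\<epsilon>foc \<epsilon>pf \<epsilon>cs \<epsilon>pd \<epsilon>soc.
            \<epsilon>foc > 0 \<and> \<epsilon>pf > 0 \<and> \<epsilon>cs > 0 \<and> \<epsilon>pd > 0 \<and> \<epsilon>soc > 0 \<and>
            \<epsilon>foc = \<epsilon>1 \<and>
            \<epsilon>pf = \<epsilon>2 \<and>
            \<epsilon>cs \<le> Kcs b J s H * (\<epsilon>1 + \<epsilon>2) \<and>
            \<epsilon>pd \<le> Kpd b J s H * (\<epsilon>1 / \<zeta> powr (1/2) + \<epsilon>2 + \<epsilon>3) \<and>
            \<epsilon>soc \<le> Ksoc b J s H * (\<epsilon>3 + \<epsilon>3 / \<zeta> + \<epsilon>1 / \<zeta> powr (3/2)) \<and>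
            NLP_approx_2N_point f c a x s \<epsilon>foc \<epsilon>pf \<epsilon>cs \<epsilon>pd \<epsilon>soc \<zeta>"
        unfolding powr
        by (rule exI[of _ \<epsilon>1], rule exI[of _ \<epsilon>2], rule exI[of _ ?cs], rule exI[of _ ?pd],
            rule exI[of _ ?soc], intro conjI pos eps refl order_refl nlp)
    qed
  qed
qed

end
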